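(* Suppose $f:\mathbb{R}^d\to\mathbb{R}$ is differentiable with $\nabla f$ Lipschitz continuous with constant $L_f$, and $g:\mathbb{R}^d\to\mathbb{R}\cup\{+\infty\}$ is proper, lower semicontinuous and $\rho$-weakly convex, and let $\varphi=f+g$. Then $$Y^{\rm FB}_{f,g}(u^k,\gamma_k)\to\mathrm{proj}_{\overline{\mathrm{dom}(\varphi)}}(\bar u)$$ whenever $u^k\to\bar u$ in $\mathbb{R}^d$ and $\gamma_k\downarrow0$ (with $\gamma_k>0$).
   Context: A function $g$ is $\rho$-weakly convex ($\rho\ge0$) if $g+\frac{\rho}{2}\|\cdot\|^2$ is convex. $\mathrm{dom}(\varphi)=\{x:\varphi(x)<+\infty\}$; the overline denotes closure, and $\mathrm{proj}_C$ is the Euclidean projection onto the closed convex set $C$. $\mathrm{prox}_{\gamma g}(x):=\mathrm{argmin}_{y\in\mathbb{R}^d}\{g(y)+\frac1{2\gamma}\|y-x\|^2\}$, which is single-valued for $\gamma\in(0,\rho^{-1})$ (with $0^{-1}=+\infty$), hence for $\gamma=\gamma_k$ with $k$ large. The forward-backward map is $Y^{\rm FB}_{f,g}(x,\gamma):=\mathrm{prox}_{\gamma g}(x-\gamma\nabla f(x))$. *)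

theory Defs
  imports "HOL-Analysis.Analysis"
begin

text \<open>Functions with values in \<open>\<real> \<union> {+\<infinity>}\<close> are \<^typ>\<open>ereal\<close>-valued functions; the value
  \<open>-\<infinity>\<close> is excluded by \<open>proper_fun\<close>.\<close>

definition proper_fun :: "('a \<Rightarrow> ereal) \<Rightarrow> bool" where
  "proper_fun g \<longleftrightarrow> (\<forall>x. g x \<noteq> -\<infinity>) \<and> (\<exists>x. g x \<noteq> \<infinity>)"

definition eff_dom :: "('a \<Rightarrow> ereal) \<Rightarrow> 'a set" where
  "eff_dom g = {x. g x < \<infinity>}"

definition lsc :: "('a::topological_space \<Rightarrow> ereal) \<Rightarrow> bool" where
  "lsc g \<longleftrightarrow> (\<forall>x. g x \<le> Liminf (at x) g)"

text \<open>The library's \<^const>\<open>convex_on\<close> covers real-valued functions only. In \<^typ>\<open>ereal\<close> we have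
  \<open>0 * \<infinity> = 0\<close>, so the inequality is trivially true when \<open>u = 0\<close> or \<open>v = 0\<close>.\<close>

definition convex_ereal :: "('a::real_vector \<Rightarrow> ereal) \<Rightarrow> bool" where
  "convex_ereal h \<longleftrightarrow>
     (\<forall>x y. \<forall>u\<ge>0. \<forall>v\<ge>0. u + v = 1 \<longrightarrow>
        h (u *\<^sub>R x + v *\<^sub>R y) \<le> ereal u * h x + ereal v * h y)"

definition weakly_convex :: "real \<Rightarrow> ('a::real_normed_vector \<Rightarrow> ereal) \<Rightarrow> bool" where
  "weakly_convex \<rho> g \<longleftrightarrow> 0 \<le> \<rho> \<and> convex_ereal (\<lambda>x. g x + ereal (\<rho> / 2 * (norm x)\<^sup>2))"

definition gradient :: "('a::real_inner \<Rightarrow> real) \<Rightarrow> 'a \<Rightarrow> 'a" where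
  "gradient f x = (THE D. GDERIV f x :> D)"

definition prox :: "real \<Rightarrow> ('a::real_normed_vector \<Rightarrow> ereal) \<Rightarrow> 'a \<Rightarrow> 'a set" where
  "prox \<gamma> g x =
     {y. is_arg_min (\<lambda>z. g z + ereal (1 / (2 * \<gamma>) * (norm (z - x))\<^sup>2)) (\<lambda>_. True) y}"

text \<open>\<^const>\<open>prox\<close> is the set of all minimizers. The forward-backward map is its unique element and
  is meaningful only where that set is a singleton, as it is for \<open>\<gamma> > 0\<close> with \<open>\<gamma> * \<rho> < 1\<close>
  when \<open>g\<close> is proper, lower semicontinuous and \<open>\<rho>\<close>-weakly convex on a Euclidean space.\<close>

definition forward_backward ::
  "('a::real_inner \<Rightarrow> real) \<Rightarrow> ('a \<Rightarrow> ereal) \<Rightarrow> 'a \<Rightarrow> real \<Rightarrow> 'a" where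
  "forward_backward f g x \<gamma> = the_elem (prox \<gamma> g (x - \<gamma> *\<^sub>R gradient f x))"

end

theory Submission
  imports Defs
begin

text \<open>A proper, lower semicontinuous, weakly convex \<open>g\<close> lies above \<open>a - b \<parallel>y\<parallel> - \<rho>/2 \<parallel>y\<parallel>\<^sup>2\<close>: near a
  point of its domain by semicontinuity, and everywhere else by convexity along rays. Hence for
  \<open>\<gamma>\<rho> < 1\<close> the proximal objective is bounded below and strongly convex, its minimizing sequences
  are Cauchy, and the proximal point \<open>y\<close> exists and is unique. With \<open>v\<^sub>k = u\<^sub>k - \<gamma>\<^sub>k \<nabla>f(u\<^sub>k) \<rightarrow> ubar\<close>,
  multiplying the minimality inequality by \<open>2\<gamma>\<^sub>k\<close> and using the minorant gives
  \<open>limsup \<parallel>y\<^sub>k - ubar\<parallel> \<le> \<parallel>z - ubar\<parallel>\<close> for every \<open>z\<close> in the domain. As \<open>y\<^sub>k\<close> is itself in the domain, the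
  obtuse-angle property of the projection \<open>p\<close>, in the form
  \<open>\<parallel>y\<^sub>k - p\<parallel>\<^sup>2 \<le> \<parallel>y\<^sub>k - ubar\<parallel>\<^sup>2 - \<parallel>p - ubar\<parallel>\<^sup>2\<close>, forces \<open>y\<^sub>k \<rightarrow> p\<close>.\<close>

section \<open>Weak convexity on the effective domain\<close>

lemma proper_fun_eff_dom:
  assumes "proper_fun g" and "x \<in> eff_dom g"
  shows "g x = ereal (real_of_ereal (g x))"
  using assms by (cases "g x") (auto simp: proper_fun_def eff_dom_def)

text \<open>Finite values at the endpoints force a finite value in between, so the extended
  inequality turns into a real one. Membership in \<open>eff_dom g\<close> matters for the real
  form, because \<open>real_of_ereal\<close> sends \<infinity> to 0.\<close>

lemma weakly_convex_eff_dom: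
  fixes g :: "'a::real_normed_vector \<Rightarrow> ereal"
  assumes "proper_fun g" and "weakly_convex \<rho> g"
    and "x \<in> eff_dom g" and "y \<in> eff_dom g"
    and "0 \<le> s" and "0 \<le> t" and "s + t = 1"
  defines "z \<equiv> s *\<^sub>R x + t *\<^sub>R y"
  shows "z \<in> eff_dom g"
    and "real_of_ereal (g z) + \<rho> / 2 * (norm z)\<^sup>2
      \<le> s * (real_of_ereal (g x) + \<rho> / 2 * (norm x)\<^sup>2)
        + t * (real_of_ereal (g y) + \<rho> / 2 * (norm y)\<^sup>2)"
proof -
  have ineq: "g z + ereal (\<rho> / 2 * (norm z)\<^sup>2)
     \<le> ereal s * (g x + ereal (\<rho> / 2 * (norm x)\<^sup>2)) + ereal t * (g y + ereal (\<rho> / 2 * (norm y)\<^sup>2))"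
    using assms unfolding weakly_convex_def convex_ereal_def by blast
  obtain a b where ab: "g x = ereal a" "g y = ereal b"
    using assms proper_fun_eff_dom by metis
  have "g z \<noteq> -\<infinity>"
    using assms(1) by (simp add: proper_fun_def)
  moreover have "g z \<noteq> \<infinity>"
    using ineq by (auto simp: ab)
  ultimately obtain c where c: "g z = ereal c"
    by (cases "g z") auto
  then show "z \<in> eff_dom g"
    by (simp add: eff_dom_def)
  show "real_of_ereal (g z) + \<rho> / 2 * (norm z)\<^sup>2
      \<le> s * (real_of_ereal (g x) + \<rho> / 2 * (norm x)\<^sup>2)
        + t * (real_of_ereal (g y) + \<rho> / 2 * (norm y)\<^sup>2)"
    using ineq by (simp add: ab c)
qed

lemma convex_eff_dom:
  fixes g :: "'a::real_normed_vector \<Rightarrow> ereal"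
  assumes "proper_fun g" and "weakly_convex \<rho> g"
  shows "convex (eff_dom g)"
  using weakly_convex_eff_dom(1)[OF assms] by (simp add: convex_def)

text \<open>The parallelogram identity evaluates the quadratic term at the midpoint; its defect, a
  quarter of the squared distance, times \<open>\<rho> / 2\<close> gives
  \<open>\<rho> / 8\<close>.\<close>

lemma weakly_convex_midpoint:
  fixes g :: "'a::real_inner \<Rightarrow> ereal"
  assumes "proper_fun g" and "weakly_convex \<rho> g"
    and "x \<in> eff_dom g" and "y \<in> eff_dom g"
  shows "midpoint x y \<in> eff_dom g"
    and "real_of_ereal (g (midpoint x y))
      \<le> (real_of_ereal (g x) + real_of_ereal (g y)) / 2 + \<rho> / 8 * (norm (x - y))\<^sup>2"
proof -
  have m: "(1/2) *\<^sub>R x + (1/2) *\<^sub>R y = midpoint x y"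
    by (simp add: midpoint_def scaleR_add_right)
  note wc = weakly_convex_eff_dom[OF assms, of "1/2" "1/2", unfolded m]
  show "midpoint x y \<in> eff_dom g"
    using wc(1) by simp
  have "(norm (midpoint x y))\<^sup>2 = (norm x)\<^sup>2 / 2 + (norm y)\<^sup>2 / 2 - (norm (x - y))\<^sup>2 / 4"
    unfolding midpoint_def power2_norm_eq_inner
    by (simp add: inner_add_left inner_add_right inner_diff_left inner_diff_right inner_commute field_simps)
  then have "\<rho> / 2 * (norm (midpoint x y))\<^sup>2
      = \<rho> / 2 * ((norm x)\<^sup>2 / 2 + (norm y)\<^sup>2 / 2 - (norm (x - y))\<^sup>2 / 4)"
    by simp
  then show "real_of_ereal (g (midpoint x y))
      \<le> (real_of_ereal (g x) + real_of_ereal (g y)) / 2 + \<rho> / 8 * (norm (x - y))\<^sup>2"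
    using wc(2) by (simp add: algebra_simps add_divide_distrib)
qed

section \<open>Lower semicontinuity and the global minorant\<close>

lemma lsc_eventually_gt:
  assumes "lsc g" and "c < g x"
  shows "\<forall>\<^sub>F y in nhds x. c < g y"
proof -
  have "g x \<le> Liminf (at x) g"
    using assms(1) by (simp add: lsc_def)
  then have "\<forall>\<^sub>F y in at x. c < g y"
    using assms(2) by (simp add: le_Liminf_iff)
  \<comment> \<open>The filter \<open>at x\<close> omits \<open>x\<close> itself, where the bound is
    the assumption \<open>c < g x\<close>.\<close>
  then show ?thesis
    using assms(2) by (auto simp: eventually_at_filter elim: eventually_mono)
qed

lemma weakly_convex_minorant:
  fixes g :: "'a::real_normed_vector \<Rightarrow> ereal"
  assumes "proper_fun g" and "lsc g" and "weakly_convex \<rho> g"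
  obtains a b where "0 \<le> b"
    and "\<And>y. y \<in> eff_dom g \<Longrightarrow> a - b * norm y - \<rho> / 2 * (norm y)\<^sup>2 \<le> real_of_ereal (g y)"
proof -
  define h where "h y = real_of_ereal (g y) + \<rho> / 2 * (norm y)\<^sup>2" for y
  have rho: "0 \<le> \<rho>"
    using assms(3) by (simp add: weakly_convex_def)
  obtain x where x: "x \<in> eff_dom g"
    using assms(1) by (auto simp: proper_fun_def eff_dom_def)
  have "ereal (real_of_ereal (g x) - 1) < ereal (real_of_ereal (g x))"
    by simp
  then have "ereal (real_of_ereal (g x) - 1) < g x"
    using proper_fun_eff_dom[OF assms(1) x] by simp
  then have "\<forall>\<^sub>F y in nhds x. ereal (real_of_ereal (g x) - 1) < g y"
    by (rule lsc_eventually_gt[OF assms(2)])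
  moreover have "((\<lambda>y. \<rho> / 2 * (norm y)\<^sup>2) \<longlongrightarrow> \<rho> / 2 * (norm x)\<^sup>2) (nhds x)"
    by (intro tendsto_intros filterlim_ident)
  then have "\<forall>\<^sub>F y in nhds x. \<rho> / 2 * (norm x)\<^sup>2 - 1 < \<rho> / 2 * (norm y)\<^sup>2"
    by (rule order_tendstoD) simp
  \<comment> \<open>One unit of slack comes from semicontinuity of \<open>g\<close>, the other from
    continuity of the quadratic term.\<close>
  ultimately have "\<forall>\<^sub>F y in nhds x. y \<in> eff_dom g \<longrightarrow> h x - 2 \<le> h y"
  proof eventually_elim
    case (elim y)
    show ?case
    proof
      assume "y \<in> eff_dom g"
      then obtain c where "g y = ereal c"
        using proper_fun_eff_dom[OF assms(1)] by metis
      then show "h x - 2 \<le> h y"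
        using elim by (simp add: h_def)
    qed
  qed
  then obtain e where e: "e > 0" "\<And>y. dist y x < e \<Longrightarrow> y \<in> eff_dom g \<Longrightarrow> h x - 2 \<le> h y"
    unfolding eventually_nhds_metric by blast
  \<comment> \<open>Halving makes the bound hold on the closed ball of radius \<open>r\<close>,
    whose boundary is used next.\<close>
  define r where "r = e / 2"
  have r: "r > 0" "\<And>y. norm (y - x) \<le> r \<Longrightarrow> y \<in> eff_dom g \<Longrightarrow> h x - 2 \<le> h y"
    using e by (auto simp: r_def dist_norm)
  have bound: "h x - 2 - 2 / r * norm (y - x) \<le> h y" if y: "y \<in> eff_dom g" for y
  proof (cases "norm (y - x) \<le> r")
    case True
    then have "0 \<le> 2 / r * norm (y - x)"
      using r(1) by simp
    then show ?thesis
      using r(2)[OF True y] by linarith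
  next
    case False
    \<comment> \<open>With this \<open>s\<close> the point \<open>z\<close> is where the segment
      from \<open>x\<close> to \<open>y\<close> crosses the sphere of radius \<open>r\<close>. There
      \<open>h\<close> has dropped by at most 2, so by convexity it drops by at most
      \<open>2 / s\<close> at \<open>y\<close>, which is linear in the distance.\<close>
    define s where "s = r / norm (y - x)"
    have pos: "norm (y - x) > 0"
      using False r(1) by linarith
    have s: "0 < s" "s \<le> 1"
      using False r(1) pos by (auto simp: s_def)
    define z where "z = (1 - s) *\<^sub>R x + s *\<^sub>R y"
    have zx: "z - x = s *\<^sub>R (y - x)"
      by (simp add: z_def algebra_simps)
    have "norm (z - x) = r"
      unfolding zx using r(1) pos by (simp add: s_def)
    moreover have "z \<in> eff_dom g" and hz: "h z \<le> (1 - s) * h x + s * h y"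
      using weakly_convex_eff_dom[OF assms(1,3) x y, of "1 - s" s] s
      by (simp_all add: z_def h_def)
    ultimately have "h x - 2 \<le> h z"
      using r(2) by simp
    then have "s * (h x - 2 / s) \<le> s * h y"
      using hz s by (simp add: algebra_simps)
    then have "h x - 2 / s \<le> h y"
      using s(1) by simp
    moreover have "2 / s = 2 / r * norm (y - x)"
      by (simp add: s_def)
    ultimately show ?thesis by simp
  qed
  show thesis
  proof (rule that)
    show "0 \<le> 2 / r"
      using r(1) by simp
    fix y assume y: "y \<in> eff_dom g"
    have "2 / r * norm (y - x) \<le> 2 / r * (norm y + norm x)"
      using r(1) by (intro mult_left_mono norm_triangle_ineq4) simp
    then show "h x - 2 - 2 / r * norm x - 2 / r * norm y - \<rho> / 2 * (norm y)\<^sup>2 \<le> real_of_ereal (g y)"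
      using bound[OF y] by (simp add: h_def distrib_left)
  qed
qed

section \<open>Existence and uniqueness of the proximal point\<close>

lemma quadratic_lower_bound:
  fixes q :: real
  assumes "q > 0"
  shows "- (s\<^sup>2 / (2 * q)) \<le> q / 2 * t\<^sup>2 - s * t"
proof -
  have "q / 2 * t\<^sup>2 - s * t + s\<^sup>2 / (2 * q) = (q * t - s)\<^sup>2 / (2 * q)"
    using assms by (simp add: field_simps power2_eq_square)
  moreover have "\<dots> \<ge> 0"
    using assms by simp
  ultimately show ?thesis by linarith
qed

lemma prox_singleton:
  fixes g :: "'a::{real_inner, complete_space} \<Rightarrow> ereal"
  assumes "proper_fun g" and "lsc g" and "weakly_convex \<rho> g"
    and "\<gamma> > 0" and "\<gamma> * \<rho> < 1"
  obtains y where "prox \<gamma> g x = {y}" and "y \<in> eff_dom g"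
    and "\<And>z. z \<in> eff_dom g \<Longrightarrow>
      real_of_ereal (g y) + 1 / (2 * \<gamma>) * (norm (y - x))\<^sup>2
        \<le> real_of_ereal (g z) + 1 / (2 * \<gamma>) * (norm (z - x))\<^sup>2"
proof -
  \<comment> \<open>The strong convexity modulus of the proximal objective:
    \<open>1 / \<gamma>\<close> from the quadratic, less the \<open>\<rho>\<close> that
    \<open>g\<close> may lack.\<close>
  define q where "q = 1 / \<gamma> - \<rho>"
  have q: "q > 0"
    using assms(4,5) by (simp add: q_def field_simps)
  define c where "c z = 1 / (2 * \<gamma>) * (norm (z - x))\<^sup>2" for z
  define H where "H z = real_of_ereal (g z) + c z" for z
  let ?D = "eff_dom g"
  have H: "g z + ereal (c z) = ereal (H z)" if "z \<in> ?D" for z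
    using proper_fun_eff_dom[OF assms(1) that] by (simp add: H_def flip: plus_ereal.simps(1))
  have ne: "?D \<noteq> {}"
    using assms(1) by (auto simp: proper_fun_def eff_dom_def)
  obtain a b where ab: "0 \<le> b"
    "\<And>y. y \<in> ?D \<Longrightarrow> a - b * norm y - \<rho> / 2 * (norm y)\<^sup>2 \<le> real_of_ereal (g y)"
    using weakly_convex_minorant[OF assms(1-3)] by metis
  have bdd: "bdd_below (H ` ?D)"
  proof (rule bdd_belowI2)
    fix y assume y: "y \<in> ?D"
    \<comment> \<open>This bounds \<open>H y\<close> below by a quadratic in \<open>norm y\<close>
      with leading coefficient \<open>q / 2\<close>; completing the square bounds that
      quadratic.\<close>
    have "(norm y - norm x)\<^sup>2 \<le> (norm (y - x))\<^sup>2"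
      using norm_triangle_ineq3[of y x] by (metis abs_le_square_iff abs_norm_cancel)
    then have "1 / (2 * \<gamma>) * (norm y - norm x)\<^sup>2 \<le> c y"
      unfolding c_def using assms(4) by (intro mult_left_mono) auto
    moreover have "1 / (2 * \<gamma>) * (norm y - norm x)\<^sup>2
        = 1 / (2 * \<gamma>) * (norm y)\<^sup>2 + 1 / (2 * \<gamma>) * (norm x)\<^sup>2 - norm x / \<gamma> * norm y"
      using assms(4) by (simp add: power2_eq_square field_simps)
    moreover have "0 \<le> 1 / (2 * \<gamma>) * (norm x)\<^sup>2"
      using assms(4) by simp
    moreover have "q / 2 * (norm y)\<^sup>2 = 1 / (2 * \<gamma>) * (norm y)\<^sup>2 - \<rho> / 2 * (norm y)\<^sup>2"
      by (simp add: q_def field_simps)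
    moreover have "(b + norm x / \<gamma>) * norm y = b * norm y + norm x / \<gamma> * norm y"
      by (simp add: distrib_right)
    ultimately show "a - (b + norm x / \<gamma>)\<^sup>2 / (2 * q) \<le> H y"
      using ab(2)[OF y] quadratic_lower_bound[OF q, of "b + norm x / \<gamma>" "norm y"]
      unfolding H_def by linarith
  qed
  define I where "I = Inf (H ` ?D)"
  have I_le: "I \<le> H z" if "z \<in> ?D" for z
    unfolding I_def using bdd that by (simp add: cInf_lower)
  \<comment> \<open>The objective at the midpoint is at least \<open>I\<close>, yet lies below the
    average by \<open>q / 8\<close> times the squared distance. This one estimate yields both the
    Cauchy property and uniqueness.\<close>
  have dist_bound: "(norm (y - z))\<^sup>2 \<le> 4 / q * ((H y - I) + (H z - I))"
    if yz: "y \<in> ?D" "z \<in> ?D" for y z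
  proof -
    note mid = weakly_convex_midpoint[OF assms(1,3) yz]
    have "(norm (midpoint y z - x))\<^sup>2
        = (norm (y - x))\<^sup>2 / 2 + (norm (z - x))\<^sup>2 / 2 - (norm (y - z))\<^sup>2 / 4"
      unfolding midpoint_def power2_norm_eq_inner
      by (simp add: inner_add_left inner_add_right inner_diff_left inner_diff_right inner_commute field_simps)
    then have "c (midpoint y z) = 1 / (2 * \<gamma>)
        * ((norm (y - x))\<^sup>2 / 2 + (norm (z - x))\<^sup>2 / 2 - (norm (y - z))\<^sup>2 / 4)"
      by (simp only: c_def)
    then have "c (midpoint y z) = (c y + c z) / 2 - 1 / (8 * \<gamma>) * (norm (y - z))\<^sup>2"
      by (simp add: c_def algebra_simps add_divide_distrib)
    then have "H (midpoint y z) \<le> (H y + H z) / 2 - q / 8 * (norm (y - z))\<^sup>2"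
      using mid(2) by (simp add: H_def q_def field_simps)
    then have "q / 8 * (norm (y - z))\<^sup>2 \<le> (H y + H z) / 2 - I"
      using I_le[OF mid(1)] by linarith
    then show ?thesis
      using q by (simp add: field_simps)
  qed
  have "\<exists>w. w \<in> ?D \<and> H w < I + 1 / real (Suc n)" for n
    using cInf_lessD[of "H ` ?D" "I + 1 / real (Suc n)"] ne by (auto simp: I_def)
  then obtain w where w: "\<And>n. w n \<in> ?D" "\<And>n. H (w n) < I + 1 / real (Suc n)"
    by metis
  have Hlim: "(\<lambda>n. H (w n)) \<longlonglongrightarrow> I"
  proof (rule tendsto_sandwich)
    show "\<forall>\<^sub>F n in sequentially. I \<le> H (w n)"
      using I_le w(1) by simp
    show "\<forall>\<^sub>F n in sequentially. H (w n) \<le> I + inverse (real (Suc n))"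
      using w(2) by (simp add: less_imp_le inverse_eq_divide)
    show "(\<lambda>n. I + inverse (real (Suc n))) \<longlonglongrightarrow> I"
      using tendsto_add[OF tendsto_const[of I] LIMSEQ_inverse_real_of_nat] by simp
  qed simp
  have "Cauchy w"
  proof (rule metric_CauchyI)
    fix e :: real assume e: "0 < e"
    \<comment> \<open>Two excesses below \<open>q * e\<^sup>2 / 8\<close>, multiplied by the factor
      \<open>4 / q\<close> of \<open>dist_bound\<close>, add up to less than the square of
      \<open>e\<close>.\<close>
    then have "I < I + q * e\<^sup>2 / 8"
      using q by simp
    then have "\<forall>\<^sub>F n in sequentially. H (w n) < I + q * e\<^sup>2 / 8"
      by (rule order_tendstoD(2)[OF Hlim])
    then obtain N where N: "\<And>n. n \<ge> N \<Longrightarrow> H (w n) < I + q * e\<^sup>2 / 8"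
      by (auto simp: eventually_sequentially)
    have "dist (w m) (w n) < e" if "m \<ge> N" "n \<ge> N" for m n
    proof -
      have "(norm (w m - w n))\<^sup>2 \<le> 4 / q * ((H (w m) - I) + (H (w n) - I))"
        by (rule dist_bound) (rule w(1))+
      also have "\<dots> < 4 / q * (q * e\<^sup>2 / 4)"
        using N[OF that(1)] N[OF that(2)] q by (intro mult_strict_left_mono) auto
      also have "\<dots> = e\<^sup>2"
        using q by simp
      finally show ?thesis
        using e by (simp add: dist_norm power2_less_imp_less)
    qed
    then show "\<exists>M. \<forall>m\<ge>M. \<forall>n\<ge>M. dist (w m) (w n) < e"
      by blast
  qed
  then obtain y where y: "w \<longlonglongrightarrow> y"
    using convergent_def by (metis Cauchy_convergent_iff)
  have clim: "(\<lambda>n. c (w n)) \<longlonglongrightarrow> c y"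
    unfolding c_def by (intro tendsto_intros y)
  \<comment> \<open>Otherwise a level \<open>r\<close> strictly above \<open>I - c y\<close> would
    eventually lie below \<open>g (w n)\<close>, that is below \<open>H (w n) - c (w n)\<close>,
    which tends to \<open>I - c y\<close>. The case of infinite \<open>g y\<close> is covered
    too.\<close>
  have gy: "g y \<le> ereal (I - c y)"
  proof (rule ccontr)
    assume "\<not> g y \<le> ereal (I - c y)"
    then obtain r where r: "I - c y < r" "ereal r < g y"
      using ereal_dense2[of "ereal (I - c y)" "g y"] by (auto simp: not_le)
    have "\<forall>\<^sub>F n in sequentially. ereal r < g (w n)"
      by (rule eventually_compose_filterlim[OF lsc_eventually_gt[OF assms(2) r(2)] y])
    then have "\<forall>\<^sub>F n in sequentially. r \<le> H (w n) - c (w n)"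
    proof eventually_elim
      case (elim n)
      then show ?case
        using proper_fun_eff_dom[OF assms(1) w(1)[of n]]
        by (metis H_def add_diff_cancel_right' ereal_less_eq(3) less_imp_le)
    qed
    then have "r \<le> I - c y"
      by (intro tendsto_lowerbound[OF tendsto_diff[OF Hlim clim]]) auto
    then show False
      using r(1) by simp
  qed
  then have yD: "y \<in> ?D"
    by (auto simp: eff_dom_def)
  have Hy: "H y \<le> I"
    using gy proper_fun_eff_dom[OF assms(1) yD]
    by (metis H_def ereal_less_eq(3) le_diff_eq)
  have prox_iff: "z \<in> prox \<gamma> g x \<longleftrightarrow> (\<forall>z'. g z + ereal (c z) \<le> g z' + ereal (c z'))" for z
    by (auto simp: prox_def is_arg_min_def c_def not_less)
  have "y \<in> prox \<gamma> g x"
    unfolding prox_iff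
  proof
    fix z
    show "g y + ereal (c y) \<le> g z + ereal (c z)"
    proof (cases "z \<in> ?D")
      case True
      then show ?thesis
        using Hy I_le[OF True] by (simp add: H yD)
    next
      case False
      then show ?thesis
        by (simp add: eff_dom_def)
    qed
  qed
  moreover have "z = y" if "z \<in> prox \<gamma> g x" for z
  proof -
    \<comment> \<open>Comparison with \<open>y\<close> puts \<open>z\<close> in the domain with no
      excess over \<open>I\<close>, so \<open>dist_bound\<close> leaves no distance.\<close>
    have le: "g z + ereal (c z) \<le> ereal (H y)"
      using that H[OF yD] unfolding prox_iff by metis
    then have zD: "z \<in> ?D"
      by (auto simp: eff_dom_def)
    have "H z \<le> I"
      using le Hy by (simp add: H[OF zD])
    then have "4 / q * ((H z - I) + (H y - I)) \<le> 0"
      using Hy q by (intro mult_nonneg_nonpos) auto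
    then have "(norm (z - y))\<^sup>2 \<le> 0"
      using dist_bound[OF zD yD] by linarith
    then show "z = y"
      by simp
  qed
  ultimately have "prox \<gamma> g x = {y}"
    by blast
  then show thesis
    using that yD Hy I_le unfolding H_def c_def by (meson order_trans)
qed

section \<open>Estimates for small step sizes\<close>

lemma prox_norm_bound:
  fixes v y z :: "'a::real_inner"
  assumes "\<gamma> > 0" and "0 \<le> C"
    and minorant: "- C * (1 + (norm y)\<^sup>2) \<le> gy"
    and min: "gy + 1 / (2 * \<gamma>) * (norm (y - v))\<^sup>2 \<le> gz + 1 / (2 * \<gamma>) * (norm (z - v))\<^sup>2"
  shows "(1 - 4 * C * \<gamma>) * (norm (y - v))\<^sup>2
    \<le> (norm (z - v))\<^sup>2 + 2 * \<gamma> * (gz + C * (1 + 2 * (norm v)\<^sup>2))"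
proof -
  \<comment> \<open>The factor \<open>2 * \<gamma>\<close> frees the squared distances of their
    coefficients and makes the terms from \<open>g\<close> small.\<close>
  have "2 * \<gamma> * (gy + 1 / (2 * \<gamma>) * (norm (y - v))\<^sup>2)
      \<le> 2 * \<gamma> * (gz + 1 / (2 * \<gamma>) * (norm (z - v))\<^sup>2)"
    using assms(1) by (intro mult_left_mono[OF min]) simp
  then have 1: "2 * \<gamma> * gy + (norm (y - v))\<^sup>2 \<le> 2 * \<gamma> * gz + (norm (z - v))\<^sup>2"
    using assms(1) by (simp add: distrib_left)
  \<comment> \<open>The doubled squared distance in this bound on the square of
    \<open>norm y\<close> is the source of the coefficient \<open>4 * C * \<gamma>\<close>.\<close>
  have "2 * (norm (y - v))\<^sup>2 + 2 * (norm v)\<^sup>2 - (norm y)\<^sup>2 = (norm (y - 2 *\<^sub>R v))\<^sup>2"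
    unfolding power2_norm_eq_inner
    by (simp add: inner_diff_left inner_diff_right inner_commute algebra_simps)
  then have "(norm y)\<^sup>2 \<le> 2 * (norm (y - v))\<^sup>2 + 2 * (norm v)\<^sup>2"
    using zero_le_power2[of "norm (y - 2 *\<^sub>R v)"] by linarith
  then have "C * (1 + (norm y)\<^sup>2) \<le> C * (1 + (2 * (norm (y - v))\<^sup>2 + 2 * (norm v)\<^sup>2))"
    using assms(2) by (intro mult_left_mono) auto
  then have "- (C * (1 + (2 * (norm (y - v))\<^sup>2 + 2 * (norm v)\<^sup>2))) \<le> gy"
    using minorant by simp
  then have "2 * \<gamma> * - (C * (1 + (2 * (norm (y - v))\<^sup>2 + 2 * (norm v)\<^sup>2))) \<le> 2 * \<gamma> * gy"
    using assms(1) by (intro mult_left_mono) auto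
  then show ?thesis
    using 1 by (simp add: algebra_simps)
qed

text \<open>Expanding about the projection leaves a cross term whose sign is given by the
  variational inequality. Nearly optimal distance to \<open>a\<close> thereby becomes closeness to
  the projection.\<close>

lemma closest_point_pythagoras:
  fixes a x :: "'a::euclidean_space"
  assumes "convex S" and "closed S" and "x \<in> S"
  shows "(norm (x - closest_point S a))\<^sup>2 \<le> (norm (x - a))\<^sup>2 - (norm (closest_point S a - a))\<^sup>2"
proof -
  let ?p = "closest_point S a"
  have "inner (a - ?p) (x - ?p) \<le> 0"
    by (rule closest_point_dot[OF assms])
  moreover have "(norm (x - a))\<^sup>2 - (norm (?p - a))\<^sup>2 - (norm (x - ?p))\<^sup>2 = - 2 * inner (a - ?p) (x - ?p)"
    unfolding power2_norm_eq_inner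
    by (simp add: inner_diff_left inner_diff_right inner_commute)
  ultimately show ?thesis by linarith
qed

text \<open>Arbitrary convergent centres \<open>v\<close> are allowed, so that the gradient step
  enters only as a vanishing perturbation.\<close>

lemma prox_tendsto_closest_point:
  fixes g :: "'a::euclidean_space \<Rightarrow> ereal"
  assumes "proper_fun g" and "lsc g" and "weakly_convex \<rho> g"
    and v: "v \<longlonglongrightarrow> ubar" and \<gamma>: "\<And>k. \<gamma> k > 0" "\<gamma> \<longlonglongrightarrow> 0"
  shows "(\<lambda>k. the_elem (prox (\<gamma> k) g (v k))) \<longlonglongrightarrow> closest_point (closure (eff_dom g)) ubar"
proof (rule metric_LIMSEQ_I)
  let ?D = "eff_dom g"
  define p where "p = closest_point (closure ?D) ubar"
  define y where "y k = the_elem (prox (\<gamma> k) g (v k))" for k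
  have ne: "?D \<noteq> {}"
    using assms(1) by (auto simp: proper_fun_def eff_dom_def)
  have cvx: "convex (closure ?D)"
    by (rule convex_closure[OF convex_eff_dom[OF assms(1,3)]])
  have rho: "0 \<le> \<rho>"
    using assms(3) by (simp add: weakly_convex_def)
  obtain a b where ab: "0 \<le> b"
    "\<And>y. y \<in> ?D \<Longrightarrow> a - b * norm y - \<rho> / 2 * (norm y)\<^sup>2 \<le> real_of_ereal (g y)"
    using weakly_convex_minorant[OF assms(1-3)] by metis
  \<comment> \<open>One constant absorbs the constant, linear and quadratic parts of the minorant,
    giving the form that \<open>prox_norm_bound\<close> expects.\<close>
  define C where "C = \<bar>a\<bar> + b + \<rho> / 2"
  have C: "0 \<le> C"
    using ab(1) rho by (simp add: C_def)
  have minorant: "- C * (1 + (norm y)\<^sup>2) \<le> real_of_ereal (g y)" if "y \<in> ?D" for y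
  proof -
    have "norm y \<le> 1 + (norm y)\<^sup>2"
      using zero_le_power2[of "norm y - 1"] norm_ge_zero[of y] unfolding power2_diff by (simp; linarith)
    then have "b * norm y \<le> b * (1 + (norm y)\<^sup>2)"
      using ab(1) by (rule mult_left_mono)
    moreover have "0 \<le> \<bar>a\<bar> * (norm y)\<^sup>2"
      by simp
    moreover have "C * (1 + (norm y)\<^sup>2)
        = \<bar>a\<bar> + \<bar>a\<bar> * (norm y)\<^sup>2 + b * (1 + (norm y)\<^sup>2) + \<rho> / 2 + \<rho> / 2 * (norm y)\<^sup>2"
      by (simp add: C_def algebra_simps)
    ultimately show ?thesis
      using ab(2)[OF that] rho abs_ge_minus_self[of a] by linarith
  qed
  fix e :: real assume e: "0 < e"
  define d where "d = norm (p - ubar)"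
  have "p \<in> closure ?D"
    unfolding p_def using ne by (intro closest_point_in_set) auto
  \<comment> \<open>The projection may lie outside the domain, where \<open>g\<close> is infinite,
    so a nearby \<open>z\<close> in the domain serves as competitor. The slack
    \<open>e\<^sup>2\<close> is what remains after subtracting \<open>d\<^sup>2\<close> at the
    end.\<close>
  then have "\<exists>z\<in>?D. (norm (z - ubar))\<^sup>2 < d\<^sup>2 + e\<^sup>2"
  proof -
    obtain x where x: "\<And>n. x n \<in> ?D" "x \<longlonglongrightarrow> p"
      using \<open>p \<in> closure ?D\<close> closure_sequential by blast
    have "(\<lambda>n. (norm (x n - ubar))\<^sup>2) \<longlonglongrightarrow> d\<^sup>2"
      unfolding d_def by (intro tendsto_intros x)
    then have "\<forall>\<^sub>F n in sequentially. (norm (x n - ubar))\<^sup>2 < d\<^sup>2 + e\<^sup>2"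
      by (rule order_tendstoD) (use e in simp)
    then show ?thesis
      using x(1) eventually_happens' sequentially_bot by blast
  qed
  then obtain z where z: "z \<in> ?D" "(norm (z - ubar))\<^sup>2 < d\<^sup>2 + e\<^sup>2"
    by blast
  \<comment> \<open>Once \<open>4 * C * \<gamma> k < 1\<close>, this bounds the squared distance
    from the proximal point to \<open>v k\<close>. Adding \<open>norm (v k - ubar)\<close> to its
    root recentres the bound at \<open>ubar\<close>.\<close>
  define R where "R k = ((norm (z - v k))\<^sup>2
      + 2 * \<gamma> k * (real_of_ereal (g z) + C * (1 + 2 * (norm (v k))\<^sup>2))) / (1 - 4 * C * \<gamma> k)" for k
  have "R \<longlonglongrightarrow> ((norm (z - ubar))\<^sup>2
      + 2 * 0 * (real_of_ereal (g z) + C * (1 + 2 * (norm ubar)\<^sup>2))) / (1 - 4 * C * 0)"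
    unfolding R_def by (intro tendsto_intros v \<gamma>(2)) simp
  then have "(\<lambda>k. (sqrt (R k) + norm (v k - ubar))\<^sup>2)
      \<longlonglongrightarrow> (sqrt ((norm (z - ubar))\<^sup>2) + norm (ubar - ubar))\<^sup>2"
    by (intro tendsto_intros v) simp
  then have "\<forall>\<^sub>F k in sequentially. (sqrt (R k) + norm (v k - ubar))\<^sup>2 < d\<^sup>2 + e\<^sup>2"
    by (rule order_tendstoD) (use z(2) in simp)
  moreover have "(\<lambda>k. \<gamma> k * \<rho>) \<longlonglongrightarrow> 0 * \<rho>" "(\<lambda>k. 4 * C * \<gamma> k) \<longlonglongrightarrow> 4 * C * 0"
    by (intro tendsto_intros \<gamma>(2))+
  then have "\<forall>\<^sub>F k in sequentially. \<gamma> k * \<rho> < 1" "\<forall>\<^sub>F k in sequentially. 4 * C * \<gamma> k < 1"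
    by (auto intro: order_tendstoD)
  ultimately have "\<forall>\<^sub>F k in sequentially. dist (y k) p < e"
  proof eventually_elim
    case (elim k)
    obtain w where w: "prox (\<gamma> k) g (v k) = {w}" "w \<in> ?D"
      "real_of_ereal (g w) + 1 / (2 * \<gamma> k) * (norm (w - v k))\<^sup>2
        \<le> real_of_ereal (g z) + 1 / (2 * \<gamma> k) * (norm (z - v k))\<^sup>2"
      using prox_singleton[OF assms(1-3) \<gamma>(1) elim(2)] z(1) by metis
    have yw: "y k = w"
      by (simp add: y_def w(1))
    have "(norm (w - v k))\<^sup>2 \<le> R k"
      using prox_norm_bound[OF \<gamma>(1) C minorant[OF w(2)] w(3)] elim(3)
      by (simp add: R_def pos_le_divide_eq mult.commute)
    then have "norm (w - v k) \<le> sqrt (R k)"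
      by (rule real_le_rsqrt)
    then have "norm (w - ubar) \<le> sqrt (R k) + norm (v k - ubar)"
      using norm_triangle_ineq[of "w - v k" "v k - ubar"] by simp
    then have "(norm (w - ubar))\<^sup>2 \<le> (sqrt (R k) + norm (v k - ubar))\<^sup>2"
      by (intro power_mono) auto
    then have "(norm (w - ubar))\<^sup>2 - d\<^sup>2 < e\<^sup>2"
      using elim(1) by linarith
    moreover have "w \<in> closure ?D"
      using w(2) closure_subset by blast
    ultimately have "(norm (w - p))\<^sup>2 < e\<^sup>2"
      using closest_point_pythagoras[OF cvx closed_closure, of w ubar]
      unfolding d_def p_def by linarith
    then show ?case
      using e by (simp add: yw dist_norm power2_less_imp_less)
  qed
  then show "\<exists>N. \<forall>k\<ge>N. dist (the_elem (prox (\<gamma> k) g (v k))) (closest_point (closure ?D) ubar) < e"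
    by (simp add: eventually_sequentially y_def p_def)
qed

section \<open>The forward-backward map\<close>

theorem proposition4:
  fixes f :: "real ^ 'd \<Rightarrow> real"
    and g \<phi> :: "real ^ 'd \<Rightarrow> ereal"
    and L\<^sub>f \<rho> :: real
    and u :: "nat \<Rightarrow> real ^ 'd" and ubar :: "real ^ 'd"
    and \<gamma> :: "nat \<Rightarrow> real"
  assumes "\<And>x. f differentiable (at x)"
    and "L\<^sub>f-lipschitz_on UNIV (gradient f)"
    and "proper_fun g" and "lsc g" and "weakly_convex \<rho> g"
    and "\<phi> = (\<lambda>x. ereal (f x) + g x)"
    and "u \<longlonglongrightarrow> ubar"
    and "\<And>k. \<gamma> k > 0" and "\<gamma> \<longlonglongrightarrow> 0"
  shows "(\<lambda>k. forward_backward f g (u k) (\<gamma> k))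
           \<longlonglongrightarrow> closest_point (closure (eff_dom \<phi>)) ubar"
proof -
  \<comment> \<open>Continuity keeps the gradients along \<open>u\<close> convergent, so scaling by
    \<open>\<gamma> k\<close> sends them to 0.\<close>
  have "isCont (gradient f) ubar"
    using lipschitz_on_continuous_on[OF assms(2)] by (simp add: continuous_on_eq_continuous_at)
  then have "(\<lambda>k. gradient f (u k)) \<longlonglongrightarrow> gradient f ubar"
    using assms(7) by (rule isCont_tendsto_compose)
  then have "(\<lambda>k. u k - \<gamma> k *\<^sub>R gradient f (u k)) \<longlonglongrightarrow> ubar - 0 *\<^sub>R gradient f ubar"
    by (intro tendsto_intros assms(7,9))
  then have "(\<lambda>k. the_elem (prox (\<gamma> k) g (u k - \<gamma> k *\<^sub>R gradient f (u k))))
      \<longlonglongrightarrow> closest_point (closure (eff_dom g)) ubar"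
    by (intro prox_tendsto_closest_point[OF assms(3,4,5) _ assms(8,9)]) simp
  \<comment> \<open>Adding the finite value \<open>f x\<close> does not change where the sum is
    infinite.\<close>
  moreover have "eff_dom \<phi> = eff_dom g"
    by (auto simp: assms(6) eff_dom_def)
  ultimately show ?thesis
    by (simp add: forward_backward_def)
qed

end
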